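(* For each $n\ge1$, $\mathbf{GL}[n]\times\mathbf{S5}$ is product matching; that is, $\mathbf{GL}[n]\times\mathbf{S5}=[\mathbf{GL}[n],\mathbf{S5}]$.
   Context: Unimodal logics $\mathbf{L}$ are formulated in a propositional language with modality $\Diamond$ ($\Box=\neg\Diamond\neg$), and $\mathbf{S5}$ in a propositional language with modality $\exists$ ($\forall=\neg\exists\neg$). $\mathcal{L}_{\Diamond\exists}$ is the propositional language with both modalities. $\mathbf{GL}=\mathbf{K}+\Box(\Box p\to p)\to\Box p$. The finite depth formulae are $bd_1=\Diamond\Box p_1\to p_1$ and $bd_n=\Diamond(\Box p_n\wedge\neg bd_{n-1})\to p_n$ for $n\ge2$, and $\mathbf{GL}[n]=\mathbf{GL}+bd_n$ (the logic of $\mathbf{GL}$-frames of depth at most $n$). The fusion $\mathbf{L}\otimes\mathbf{S5}$ is the least set of $\mathcal{L}_{\Diamond\exists}$-formulae containing the theorems of $\mathbf{L}$ and $\mathbf{S5}$ and closed under Modus Ponens, Substitution, $\Box$-necessitation, and $\forall$-necessitation, and $[\mathbf{L},\mathbf{S5}]=(\mathbf{L}\otimes\mathbf{S5})+(\exists\Diamond p\to\Diamond\exists p)+(\Diamond\exists p\to\exists\Diamond p)$, the least extension containing these formulae and closed under the same rules. For Kripke frames $\mathfrak{F}=(X_1,R_1)$ and $\mathfrak{G}=(X_2,R_2)$ with $R_2$ an equivalence relation, the product frame is $\mathfrak{F}\times\mathfrak{G}=(X_1\times X_2,R,E)$, where $(x,u)R(y,v)$ iff $xR_1y$ and $u=v$,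 and $(x,u)E(y,v)$ iff $x=y$ and $uR_2v$; $R$ interprets $\Diamond$ and $E$ interprets $\exists$. For a Kripke complete unimodal logic $\mathbf{L}$, $\mathbf{L}\times\mathbf{S5}$ is the set of all $\mathcal{L}_{\Diamond\exists}$-formulae valid in all product frames $\mathfrak{F}\times\mathfrak{G}$ with $\mathfrak{F}$ an $\mathbf{L}$-frame and $\mathfrak{G}$ an $\mathbf{S5}$-frame. It is called product matching if $\mathbf{L}\times\mathbf{S5}=[\mathbf{L},\mathbf{S5}]$. *)

theory Defs
  imports Main
begin

section \<open>Formulae\<close>

text \<open>One type of formulae, parametrised by the type of modalities: unimodal formulae have type
  \<open>unit fm\<close>, formulae with both modalities type \<open>bimodality fm\<close> (below).
  \<open>Poss m\<close> is the possibility operator of the modality \<open>m\<close>; as usual it is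
  primitive and \<open>Nec m\<close> is its dual.\<close>

datatype 'm fm =
    Var nat
  | Bot
  | Imp "'m fm" "'m fm"  (infixr "\<^bold>\<rightarrow>" 55)
  | Poss 'm "'m fm"

abbreviation Neg :: "'m fm \<Rightarrow> 'm fm"  ("\<^bold>\<not> _" [70] 70)
  where "\<^bold>\<not> A \<equiv> A \<^bold>\<rightarrow> Bot"

abbreviation Conj :: "'m fm \<Rightarrow> 'm fm \<Rightarrow> 'm fm"  (infixr "\<^bold>\<and>" 65)
  where "A \<^bold>\<and> B \<equiv> \<^bold>\<not> (A \<^bold>\<rightarrow> \<^bold>\<not> B)"

abbreviation Nec :: "'m \<Rightarrow> 'm fm \<Rightarrow> 'm fm"
  where "Nec m A \<equiv> \<^bold>\<not> Poss m (\<^bold>\<not> A)"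

primrec subst :: "(nat \<Rightarrow> 'm fm) \<Rightarrow> 'm fm \<Rightarrow> 'm fm" where
  "subst s (Var i) = s i"
| "subst s Bot = Bot"
| "subst s (A \<^bold>\<rightarrow> B) = subst s A \<^bold>\<rightarrow> subst s B"
| "subst s (Poss m A) = Poss m (subst s A)"

section \<open>Logics\<close>

text \<open>Truth-functional evaluation; \<open>e\<close> assigns truth values to variables and to
  formulae starting with a modality.\<close>

primrec bool_eval :: "('m fm \<Rightarrow> bool) \<Rightarrow> 'm fm \<Rightarrow> bool" where
  "bool_eval e (Var i) = e (Var i)"
| "bool_eval e Bot = False"
| "bool_eval e (A \<^bold>\<rightarrow> B) = (bool_eval e A \<longrightarrow> bool_eval e B)"
| "bool_eval e (Poss m A) = e (Poss m A)"

definition tautologies :: "'m fm set"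
  where "tautologies = {A. \<forall>e. bool_eval e A}"

inductive_set rule_closure :: "'m fm set \<Rightarrow> 'm fm set" for \<Gamma> where
  base: "A \<in> \<Gamma> \<Longrightarrow> A \<in> rule_closure \<Gamma>"
| MP: "A \<^bold>\<rightarrow> B \<in> rule_closure \<Gamma> \<Longrightarrow> A \<in> rule_closure \<Gamma> \<Longrightarrow> B \<in> rule_closure \<Gamma>"
| Subst: "A \<in> rule_closure \<Gamma> \<Longrightarrow> subst s A \<in> rule_closure \<Gamma>"
| Necessitation: "A \<in> rule_closure \<Gamma> \<Longrightarrow> Nec m A \<in> rule_closure \<Gamma>"

text \<open>Since \<open>Poss\<close> is the primitive operator, the minimal normal logic needs, besides
  the distribution axiom for \<open>Nec\<close>, that \<open>Poss\<close> is the dual of \<open>Nec\<close>.\<close>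

definition K_axioms :: "unit fm set" where
  "K_axioms =
    {Nec () (Var 0 \<^bold>\<rightarrow> Var 1) \<^bold>\<rightarrow> Nec () (Var 0) \<^bold>\<rightarrow> Nec () (Var 1),
     Poss () (Var 0) \<^bold>\<rightarrow> \<^bold>\<not> Nec () (\<^bold>\<not> Var 0),
     \<^bold>\<not> Nec () (\<^bold>\<not> Var 0) \<^bold>\<rightarrow> Poss () (Var 0)}"

definition K_plus :: "unit fm set \<Rightarrow> unit fm set"
  where "K_plus \<Gamma> = rule_closure (tautologies \<union> K_axioms \<union> \<Gamma>)"

definition S5 :: "unit fm set" where
  "S5 = K_plus
    {Var 0 \<^bold>\<rightarrow> Poss () (Var 0),
     Poss () (Poss () (Var 0)) \<^bold>\<rightarrow> Poss () (Var 0),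
     Poss () (Var 0) \<^bold>\<rightarrow> Nec () (Poss () (Var 0))}"

definition GL_axiom :: "unit fm"
  where "GL_axiom = Nec () (Nec () (Var 0) \<^bold>\<rightarrow> Var 0) \<^bold>\<rightarrow> Nec () (Var 0)"

text \<open>Only \<open>n \<ge> 1\<close> is meaningful; the value at \<open>0\<close> is a dummy.\<close>

fun bd :: "nat \<Rightarrow> unit fm" where
  "bd 0 = Bot"
| "bd (Suc 0) = Poss () (Nec () (Var 1)) \<^bold>\<rightarrow> Var 1"
| "bd (Suc (Suc n)) =
    Poss () (Nec () (Var (Suc (Suc n))) \<^bold>\<and> \<^bold>\<not> bd (Suc n)) \<^bold>\<rightarrow> Var (Suc (Suc n))"

definition GL_depth :: "nat \<Rightarrow> unit fm set"
  where "GL_depth n = K_plus {GL_axiom, bd n}"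

section \<open>Fusion and commutator with S5\<close>

datatype bimodality = Dia | Ex

definition fusion_S5 :: "unit fm set \<Rightarrow> bimodality fm set" where
  "fusion_S5 L = rule_closure (map_fm (\<lambda>_. Dia) ` L \<union> map_fm (\<lambda>_. Ex) ` S5)"

definition commutator_S5 :: "unit fm set \<Rightarrow> bimodality fm set" where
  "commutator_S5 L = rule_closure (fusion_S5 L \<union>
    {Poss Ex (Poss Dia (Var 0)) \<^bold>\<rightarrow> Poss Dia (Poss Ex (Var 0)),
     Poss Dia (Poss Ex (Var 0)) \<^bold>\<rightarrow> Poss Ex (Poss Dia (Var 0))})"

section \<open>Kripke frames and product logics\<close>

record ('m, 'w) frame =
  worlds :: "'w set"
  acc :: "'m \<Rightarrow> ('w \<times> 'w) set"

definition kripke_frame :: "('m, 'w) frame \<Rightarrow> bool" where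
  "kripke_frame F \<longleftrightarrow> worlds F \<noteq> {} \<and> (\<forall>m. acc F m \<subseteq> worlds F \<times> worlds F)"

primrec sat :: "('m, 'w) frame \<Rightarrow> (nat \<Rightarrow> 'w set) \<Rightarrow> 'w \<Rightarrow> 'm fm \<Rightarrow> bool" where
  "sat F V w (Var i) \<longleftrightarrow> w \<in> V i"
| "sat F V w Bot \<longleftrightarrow> False"
| "sat F V w (A \<^bold>\<rightarrow> B) \<longleftrightarrow> (sat F V w A \<longrightarrow> sat F V w B)"
| "sat F V w (Poss m A) \<longleftrightarrow> (\<exists>v \<in> worlds F. (w, v) \<in> acc F m \<and> sat F V v A)"

definition valid :: "('m, 'w) frame \<Rightarrow> 'm fm \<Rightarrow> bool"
  where "valid F A \<longleftrightarrow> (\<forall>V. \<forall>w \<in> worlds F. sat F V w A)"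

definition frame_of_logic :: "'m fm set \<Rightarrow> ('m, 'w) frame \<Rightarrow> bool"
  where "frame_of_logic L F \<longleftrightarrow> kripke_frame F \<and> (\<forall>A \<in> L. valid F A)"

definition product_frame ::
    "(unit, 'a) frame \<Rightarrow> (unit, 'b) frame \<Rightarrow> (bimodality, 'a \<times> 'b) frame" where
  "product_frame F G =
    \<lparr>worlds = worlds F \<times> worlds G,
     acc = (\<lambda>m. case m of
        Dia \<Rightarrow> {((x, u), (y, v)). (x, y) \<in> acc F () \<and> u = v \<and> u \<in> worlds G}
      | Ex \<Rightarrow> {((x, u), (y, v)). x = y \<and> x \<in> worlds F \<and> (u, v) \<in> acc G ()})\<rparr>"

text \<open>A definition cannot quantify over all types, so the types \<open>'a\<close> and \<open>'b\<close> from which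
  the worlds of the two factors are drawn are explicit parameters. The worlds of a frame may
  form any nonempty subset of the type, so statements about all infinite \<open>'a\<close> and \<open>'b\<close>
  cover frames of every cardinality. The frames of \<open>S5\<close> are those whose relation is an
  equivalence on the worlds.\<close>

definition product_S5 :: "'a itself \<Rightarrow> 'b itself \<Rightarrow> unit fm set \<Rightarrow> bimodality fm set" where
  "product_S5 _ _ L =
    {A. \<forall>(F :: (unit, 'a) frame) (G :: (unit, 'b) frame).
          frame_of_logic L F \<longrightarrow> frame_of_logic S5 G \<longrightarrow> valid (product_frame F G) A}"

definition product_matching :: "'a itself \<Rightarrow> 'b itself \<Rightarrow> unit fm set \<Rightarrow> bool" where
  "product_matching a b L \<longleftrightarrow> product_S5 a b L = commutator_S5 L"

end

theory Submission
  imports Defs "HOL-Library.Countable_Set"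
begin

text \<open>\<open>GL + bd\<^sub>n\<close> contains the transitivity axiom and \<open>\<box>\<^sup>n\<bottom>\<close>, both of which are canonical. So in the
  canonical frame of the commutator, \<open>R\<close> is transitive without chains of more than \<open>n\<close> points,
  \<open>E\<close> is an equivalence, and \<open>R\<close> and \<open>E\<close> commute. Such a frame is a bounded morphic image of a
  product: the first factor is the tree of finite \<open>R \<circ> E\<close>-chains, each child repeated infinitely
  often; the second factor is the set of all bounded morphisms from this tree into the frame
  that agree up to \<open>E\<close> with the labels; and the morphism is evaluation \<open>(l, g) \<mapsto> g l\<close>. Commutation
  makes it possible to prescribe the value of such a map at one node freely within an \<open>E\<close>-class,
  and any single \<open>g\<close> shows that the tree has depth at most \<open>n\<close>. A Loewenheim-Skolem argument on the
  two factors makes them countable, so that they embed into arbitrary infinite types.\<close>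

section \<open>Soundness\<close>

lemma sat_subst: "sat F V w (subst s A) \<longleftrightarrow> sat F (\<lambda>i. {v. sat F V v (s i)}) w A"
  by (induction A arbitrary: w) auto

lemma sat_bool_eval: "sat F V w A \<longleftrightarrow> bool_eval (sat F V w) A"
  by (induction A) auto

lemma valid_tautology: "A \<in> tautologies \<Longrightarrow> valid F A"
  by (simp add: valid_def tautologies_def sat_bool_eval)

lemma valid_rule_closure:
  assumes "A \<in> rule_closure \<Gamma>" and "\<And>A. A \<in> \<Gamma> \<Longrightarrow> valid F A"
  shows "valid F A"
  using assms(1)
proof induction
  case (Subst A s)
  then show ?case by (simp add: valid_def sat_subst)
qed (use assms(2) in \<open>auto simp: valid_def\<close>)

lemma valid_K_plus:
  assumes "A \<in> K_plus \<Gamma>" and "\<And>A. A \<in> \<Gamma> \<Longrightarrow> valid F A"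
  shows "valid F A"
proof (rule valid_rule_closure[OF assms(1)[unfolded K_plus_def]])
  fix B assume "B \<in> tautologies \<union> K_axioms \<union> \<Gamma>"
  moreover have "valid F B" if "B \<in> K_axioms"
    using that by (auto simp: K_axioms_def valid_def)
  ultimately show "valid F B"
    using valid_tautology assms(2) by blast
qed

text \<open>Any natural-number rank that drops strictly along the relation can stand in for the
  length of chains. At rank 1 there are no successors, since ranks are positive; above that, all
  successors have smaller rank, so the inner \<open>bd\<close> holds there and the antecedent
  fails.\<close>

lemma sat_bd:
  fixes d :: "'w \<Rightarrow> nat"
  assumes pos: "\<And>x. x \<in> worlds F \<Longrightarrow> 1 \<le> d x"
    and less: "\<And>x y. (x, y) \<in> acc F () \<Longrightarrow> d y < d x"
  shows "n \<ge> 1 \<Longrightarrow> w \<in> worlds F \<Longrightarrow> d w \<le> n \<Longrightarrow> sat F V w (bd n)"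
proof (induction n arbitrary: w rule: bd.induct)
  case 1
  then show ?case by simp
next
  case 2
  then show ?case using pos less by fastforce
next
  case (3 n)
  have "sat F V v (bd (Suc n))" if "v \<in> worlds F" "(w, v) \<in> acc F ()" for v
    using 3 that less[OF that(2)] by simp
  then show ?case by auto
qed

lemma frame_of_GL_depth:
  fixes d :: "'w \<Rightarrow> nat"
  assumes "n \<ge> 1" and "kripke_frame F" and "trans (acc F ())"
    and bounds: "\<And>x. x \<in> worlds F \<Longrightarrow> 1 \<le> d x \<and> d x \<le> n"
    and less: "\<And>x y. (x, y) \<in> acc F () \<Longrightarrow> d y < d x"
  shows "frame_of_logic (GL_depth n) F"
proof -
  have "valid F (bd n)"
    unfolding valid_def using sat_bd[of F d] assms(1) bounds less by blast
  moreover have "valid F GL_axiom"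
  proof -
    \<comment> \<open>Well-founded induction on the rank of \<open>v\<close>. By transitivity the
      successors of \<open>v\<close> are successors of \<open>w\<close> too, so the induction
      hypothesis covers them.\<close>
    have *: "v \<in> V 0"
      if step: "\<forall>v\<in>worlds F. (w, v) \<in> acc F () \<longrightarrow>
          (\<forall>u\<in>worlds F. (v, u) \<in> acc F () \<longrightarrow> u \<in> V 0) \<longrightarrow> v \<in> V 0"
        and "v \<in> worlds F" "(w, v) \<in> acc F ()"
      for w v and V :: "nat \<Rightarrow> 'w set"
      using that(2,3)
    proof (induction "d v" arbitrary: v rule: less_induct)
      case less
      have "u \<in> V 0" if "u \<in> worlds F" "(v, u) \<in> acc F ()" for u
        using that less.hyps less.prems assms(3,5) by (meson transD)
      then show ?case
        using step less.prems by blast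
    qed
    have "sat F V w GL_axiom" for V w
    proof -
      have eq: "sat F V w GL_axiom \<longleftrightarrow>
        ((\<forall>v\<in>worlds F. (w, v) \<in> acc F () \<longrightarrow>
            (\<forall>u\<in>worlds F. (v, u) \<in> acc F () \<longrightarrow> u \<in> V 0) \<longrightarrow> v \<in> V 0) \<longrightarrow>
          (\<forall>v\<in>worlds F. (w, v) \<in> acc F () \<longrightarrow> v \<in> V 0))"
        by (simp add: GL_axiom_def) blast
      show ?thesis
        unfolding eq by (intro impI ballI) (rule *)
    qed
    then show ?thesis
      unfolding valid_def by blast
  qed
  ultimately show ?thesis
    unfolding frame_of_logic_def GL_depth_def using assms(2) valid_K_plus by blast
qed

lemma frame_of_S5:
  assumes "worlds G \<noteq> {}" and "equiv (worlds G) (acc G ())"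
  shows "frame_of_logic S5 G"
proof -
  have sub: "acc G () \<subseteq> worlds G \<times> worlds G"
    and refl: "refl_on (worlds G) (acc G ())"
    and sym: "sym (acc G ())" and trans: "trans (acc G ())"
    using assms(2) by (auto simp: equiv_def)
  have "kripke_frame G"
    using assms(1) sub by (simp add: kripke_frame_def)
  moreover have "valid G A" if "A \<in> S5" for A
    using that unfolding S5_def
  proof (rule valid_K_plus)
    fix B :: "unit fm"
    assume "B \<in> {Var 0 \<^bold>\<rightarrow> Poss () (Var 0),
       Poss () (Poss () (Var 0)) \<^bold>\<rightarrow> Poss () (Var 0),
       Poss () (Var 0) \<^bold>\<rightarrow> Nec () (Poss () (Var 0))}"
    then show "valid G B"
      unfolding valid_def
      by (auto; metis refl_onD[OF refl] symD[OF sym] transD[OF trans])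
  qed
  ultimately show ?thesis
    by (auto simp: frame_of_logic_def)
qed

text \<open>A formula with \<open>Dia\<close> only never leaves the line with second coordinate
  \<open>u\<close>, which is a copy of \<open>F\<close>.\<close>

lemma sat_product_Dia:
  assumes "u \<in> worlds G"
  shows "x \<in> worlds F \<Longrightarrow> sat (product_frame F G) V (x, u) (map_fm (\<lambda>_. Dia) A) \<longleftrightarrow>
    sat F (\<lambda>i. {x. (x, u) \<in> V i}) x A"
  using assms by (induction A arbitrary: x) (auto simp: product_frame_def)

lemma sat_product_Ex:
  assumes "x \<in> worlds F"
  shows "u \<in> worlds G \<Longrightarrow> sat (product_frame F G) V (x, u) (map_fm (\<lambda>_. Ex) A) \<longleftrightarrow>
    sat G (\<lambda>i. {u. (x, u) \<in> V i}) u A"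
  using assms by (induction A arbitrary: u) (auto simp: product_frame_def)

text \<open>The two factors are copied along the lines of the product. The commutation axioms hold
  because the two coordinates can be changed in either order.\<close>

lemma commutator_sound:
  assumes "A \<in> commutator_S5 L" and F: "frame_of_logic L F" and G: "frame_of_logic S5 G"
  shows "valid (product_frame F G) A"
proof -
  let ?P = "product_frame F G"
  have worlds: "worlds ?P = worlds F \<times> worlds G"
    by (simp add: product_frame_def)
  have fusion: "valid ?P B" if "B \<in> fusion_S5 L" for B
    using that unfolding fusion_S5_def
  proof (rule valid_rule_closure)
    fix C assume "C \<in> map_fm (\<lambda>_. Dia) ` L \<union> map_fm (\<lambda>_. Ex) ` S5"
    then show "valid ?P C"
      using F G
      by (auto simp: frame_of_logic_def valid_def worlds sat_product_Dia sat_product_Ex)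
  qed
  show ?thesis
    using assms(1) unfolding commutator_S5_def
  proof (rule valid_rule_closure)
    fix B
    assume "B \<in> fusion_S5 L \<union>
      {Poss Ex (Poss Dia (Var 0)) \<^bold>\<rightarrow> Poss Dia (Poss Ex (Var 0)),
       Poss Dia (Poss Ex (Var 0)) \<^bold>\<rightarrow> Poss Ex (Poss Dia (Var 0))}"
    then show "valid ?P B"
      using fusion F G
      by (fastforce simp: valid_def product_frame_def frame_of_logic_def kripke_frame_def)
  qed
qed

section \<open>Canonical models\<close>

text \<open>The axioms are schemes, so the canonical model can be built from instances alone and for
  any type of modalities.\<close>

locale normal_logic =
  fixes M :: "'m fm set"
  assumes taut: "tautologies \<subseteq> M"
    and mp: "A \<^bold>\<rightarrow> B \<in> M \<Longrightarrow> A \<in> M \<Longrightarrow> B \<in> M"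
    and nec: "A \<in> M \<Longrightarrow> Nec m A \<in> M"
    and K: "Nec m (A \<^bold>\<rightarrow> B) \<^bold>\<rightarrow> Nec m A \<^bold>\<rightarrow> Nec m B \<in> M"
    and dual1: "Poss m A \<^bold>\<rightarrow> \<^bold>\<not> Nec m (\<^bold>\<not> A) \<in> M"
    and dual2: "\<^bold>\<not> Nec m (\<^bold>\<not> A) \<^bold>\<rightarrow> Poss m A \<in> M"
begin

definition mp_closed :: "'m fm set \<Rightarrow> bool" where
  "mp_closed T \<longleftrightarrow> M \<subseteq> T \<and> (\<forall>A B. A \<^bold>\<rightarrow> B \<in> T \<longrightarrow> A \<in> T \<longrightarrow> B \<in> T)"

definition mcs :: "'m fm set \<Rightarrow> bool" where
  "mcs T \<longleftrightarrow> mp_closed T \<and> Bot \<notin> T \<and> (\<forall>A. A \<in> T \<or> \<^bold>\<not> A \<in> T)"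

lemma mp_closedD: "mp_closed T \<Longrightarrow> A \<^bold>\<rightarrow> B \<in> T \<Longrightarrow> A \<in> T \<Longrightarrow> B \<in> T"
  unfolding mp_closed_def by blast

lemma mp_closed_sub: "mp_closed T \<Longrightarrow> M \<subseteq> T"
  by (simp add: mp_closed_def)

lemma mp_closed_taut: "mp_closed T \<Longrightarrow> (\<And>e. bool_eval e A) \<Longrightarrow> A \<in> T"
  using taut mp_closed_sub unfolding tautologies_def by blast

lemma mp_closed_M: "mp_closed M"
  unfolding mp_closed_def by (intro conjI allI impI subset_refl) (rule mp)

text \<open>The deduction theorem in closed form: this set is the theory generated by
  \<open>T\<close> and \<open>A\<close>, obtained without induction on derivations.\<close>

lemma mp_closed_extend:
  assumes "mp_closed T"
  shows "mp_closed {B. A \<^bold>\<rightarrow> B \<in> T}" and "T \<subseteq> {B. A \<^bold>\<rightarrow> B \<in> T}" and "A \<in> {B. A \<^bold>\<rightarrow> B \<in> T}"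
proof -
  show sub: "T \<subseteq> {B. A \<^bold>\<rightarrow> B \<in> T}"
  proof
    fix B assume "B \<in> T"
    moreover have "B \<^bold>\<rightarrow> A \<^bold>\<rightarrow> B \<in> T"
      using assms by (rule mp_closed_taut) simp
    ultimately show "B \<in> {B. A \<^bold>\<rightarrow> B \<in> T}"
      using mp_closedD[OF assms, of B "A \<^bold>\<rightarrow> B"] by blast
  qed
  have "A \<^bold>\<rightarrow> C \<in> T" if "A \<^bold>\<rightarrow> B \<^bold>\<rightarrow> C \<in> T" "A \<^bold>\<rightarrow> B \<in> T" for B C
  proof -
    have "(A \<^bold>\<rightarrow> B \<^bold>\<rightarrow> C) \<^bold>\<rightarrow> (A \<^bold>\<rightarrow> B) \<^bold>\<rightarrow> (A \<^bold>\<rightarrow> C) \<in> T"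
      using assms by (rule mp_closed_taut) simp
    then show ?thesis
      using that mp_closedD[OF assms] by metis
  qed
  then show "mp_closed {B. A \<^bold>\<rightarrow> B \<in> T}"
    using sub assms unfolding mp_closed_def by blast
  show "A \<in> {B. A \<^bold>\<rightarrow> B \<in> T}"
    using mp_closed_taut[OF assms] by simp
qed

lemma lindenbaum:
  assumes "mp_closed T" and "Bot \<notin> T"
  obtains \<Gamma> where "mcs \<Gamma>" and "T \<subseteq> \<Gamma>"
proof -
  let ?S = "{T'. mp_closed T' \<and> Bot \<notin> T' \<and> T \<subseteq> T'}"
  have "\<exists>\<Gamma>\<in>?S. \<forall>X\<in>?S. \<Gamma> \<subseteq> X \<longrightarrow> X = \<Gamma>"
  proof (rule subset_Zorn_nonempty)
    show "?S \<noteq> {}" using assms by blast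
    fix \<C> assume ne: "\<C> \<noteq> {}" and chain: "subset.chain ?S \<C>"
    have "B \<in> \<Union>\<C>" if AB: "A \<^bold>\<rightarrow> B \<in> \<Union>\<C>" "A \<in> \<Union>\<C>" for A B
    proof -
      obtain X Y where XY: "X \<in> \<C>" "A \<^bold>\<rightarrow> B \<in> X" "Y \<in> \<C>" "A \<in> Y"
        using AB by blast
      then have "X \<subseteq> Y \<or> Y \<subseteq> X" "mp_closed X" "mp_closed Y"
        using chain unfolding subset_chain_def by auto
      then have "B \<in> X \<or> B \<in> Y"
        using XY mp_closedD by (meson subsetD)
      then show ?thesis using XY by blast
    qed
    moreover have "mp_closed X \<and> Bot \<notin> X \<and> T \<subseteq> X" if "X \<in> \<C>" for X
      using chain that unfolding subset_chain_def by blast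
    moreover obtain X where "X \<in> \<C>" using ne by blast
    ultimately show "\<Union>\<C> \<in> ?S"
      unfolding mp_closed_def by (simp, blast)
  qed
  then obtain \<Gamma> where \<Gamma>: "mp_closed \<Gamma>" "Bot \<notin> \<Gamma>" "T \<subseteq> \<Gamma>"
    and max: "\<And>X. mp_closed X \<Longrightarrow> Bot \<notin> X \<Longrightarrow> \<Gamma> \<subseteq> X \<Longrightarrow> X = \<Gamma>"
    by auto
  \<comment> \<open>If the extension of \<open>\<Gamma>\<close> by \<open>A\<close> omits
    \<open>Bot\<close>, maximality makes it equal to \<open>\<Gamma>\<close>, so \<open>A\<close> is
    in \<open>\<Gamma>\<close>; otherwise the negation of \<open>A\<close> is in
    \<open>\<Gamma>\<close> by definition of the extension.\<close>
  have "A \<in> \<Gamma> \<or> \<^bold>\<not> A \<in> \<Gamma>" for A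
    using max[OF mp_closed_extend(1)[OF \<Gamma>(1), of A]] mp_closed_extend(2,3)[OF \<Gamma>(1), of A]
    by blast
  then show ?thesis
    using that \<Gamma> by (auto simp: mcs_def)
qed

lemma mcs_Bot [simp]: "mcs \<Gamma> \<Longrightarrow> Bot \<notin> \<Gamma>"
  by (simp add: mcs_def)

lemma mcs_Imp [simp]:
  assumes "mcs \<Gamma>"
  shows "A \<^bold>\<rightarrow> B \<in> \<Gamma> \<longleftrightarrow> (A \<in> \<Gamma> \<longrightarrow> B \<in> \<Gamma>)"
proof -
  have T: "mp_closed \<Gamma>" and total: "A \<in> \<Gamma> \<or> \<^bold>\<not> A \<in> \<Gamma>"
    using assms by (auto simp: mcs_def)
  have "\<^bold>\<not> A \<^bold>\<rightarrow> A \<^bold>\<rightarrow> B \<in> \<Gamma>" "B \<^bold>\<rightarrow> A \<^bold>\<rightarrow> B \<in> \<Gamma>"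
    by (rule mp_closed_taut[OF T]; simp)+
  then have "A \<^bold>\<rightarrow> B \<in> \<Gamma>" if "A \<notin> \<Gamma> \<or> B \<in> \<Gamma>"
    using that total mp_closedD[OF T, of "\<^bold>\<not> A" "A \<^bold>\<rightarrow> B"] mp_closedD[OF T, of B "A \<^bold>\<rightarrow> B"] by blast
  then show ?thesis
    using mp_closedD[OF T, of A B] by blast
qed

lemma mcs_M: "mcs \<Gamma> \<Longrightarrow> A \<in> M \<Longrightarrow> A \<in> \<Gamma>"
  using mp_closed_sub unfolding mcs_def by blast

lemma exists_mcs:
  assumes "A \<notin> M"
  obtains \<Gamma> where "mcs \<Gamma>" and "A \<notin> \<Gamma>"
proof -
  have "(\<^bold>\<not> A \<^bold>\<rightarrow> Bot) \<^bold>\<rightarrow> A \<in> M"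
    by (rule mp_closed_taut[OF mp_closed_M]) simp
  then have "Bot \<notin> {B. \<^bold>\<not> A \<^bold>\<rightarrow> B \<in> M}"
    using assms mp[of "\<^bold>\<not> \<^bold>\<not> A" A] by blast
  then obtain \<Gamma> where \<Gamma>: "mcs \<Gamma>" "{B. \<^bold>\<not> A \<^bold>\<rightarrow> B \<in> M} \<subseteq> \<Gamma>"
    by (rule lindenbaum[OF mp_closed_extend(1)[OF mp_closed_M]])
  have "\<^bold>\<not> A \<in> \<Gamma>"
    using \<Gamma>(2) mp_closed_extend(3)[OF mp_closed_M] by blast
  then show ?thesis
    using that \<Gamma>(1) by auto
qed

text \<open>Reduces propositional reasoning inside \<open>M\<close> to simplification with the
  membership rules for \<open>mcs\<close>.\<close>

lemma in_M_iff: "A \<in> M \<longleftrightarrow> (\<forall>\<Gamma>. mcs \<Gamma> \<longrightarrow> A \<in> \<Gamma>)"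
  using exists_mcs mcs_M by metis

text \<open>As \<open>Poss\<close> is primitive, \<open>Nec\<close> of a negation unfolds to a
  double negation under \<open>Poss\<close>; the duality axioms remove it.\<close>

lemma mcs_dual: "mcs \<Gamma> \<Longrightarrow> Poss m (\<^bold>\<not> \<^bold>\<not> A) \<in> \<Gamma> \<longleftrightarrow> Poss m A \<in> \<Gamma>"
  using mcs_M[OF _ dual1[of m A]] mcs_M[OF _ dual2[of m A]] by auto

lemma mcs_K: "mcs \<Gamma> \<Longrightarrow> Nec m (A \<^bold>\<rightarrow> B) \<in> \<Gamma> \<Longrightarrow> Nec m A \<in> \<Gamma> \<Longrightarrow> Nec m B \<in> \<Gamma>"
  using mcs_M[OF _ K[of m A B]] mcs_Imp by metis

lemma mcs_Nec_mono2:
  assumes "mcs \<Gamma>" and "A \<^bold>\<rightarrow> B \<^bold>\<rightarrow> C \<in> M" and "Nec m A \<in> \<Gamma>" and "Nec m B \<in> \<Gamma>"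
  shows "Nec m C \<in> \<Gamma>"
  using mcs_K[OF assms(1) mcs_M[OF assms(1) nec[OF assms(2)]] assms(3)]
  by (rule mcs_K[OF assms(1) _ assms(4)])

definition can_acc :: "'m \<Rightarrow> ('m fm set \<times> 'm fm set) set" where
  "can_acc m = {(\<Gamma>, \<Delta>). mcs \<Gamma> \<and> mcs \<Delta> \<and> (\<forall>A. Nec m A \<in> \<Gamma> \<longrightarrow> A \<in> \<Delta>)}"

definition canonical :: "('m, 'm fm set) frame" where
  "canonical = \<lparr>worlds = {\<Gamma>. mcs \<Gamma>}, acc = can_acc\<rparr>"

lemma can_accD: "(\<Gamma>, \<Delta>) \<in> can_acc m \<Longrightarrow> mcs \<Gamma> \<and> mcs \<Delta>"
  by (simp add: can_acc_def)

lemma can_acc_Poss: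
  "(\<Gamma>, \<Delta>) \<in> can_acc m \<longleftrightarrow> mcs \<Gamma> \<and> mcs \<Delta> \<and> (\<forall>A\<in>\<Delta>. Poss m A \<in> \<Gamma>)"
proof -
  have "(\<forall>A. Nec m A \<in> \<Gamma> \<longrightarrow> A \<in> \<Delta>) \<longleftrightarrow> (\<forall>A\<in>\<Delta>. Poss m A \<in> \<Gamma>)"
    if \<Gamma>: "mcs \<Gamma>" and \<Delta>: "mcs \<Delta>"
  proof
    assume *: "\<forall>A. Nec m A \<in> \<Gamma> \<longrightarrow> A \<in> \<Delta>"
    show "\<forall>A\<in>\<Delta>. Poss m A \<in> \<Gamma>"
    proof
      fix A assume "A \<in> \<Delta>"
      then show "Poss m A \<in> \<Gamma>"
        using *[rule_format, of "\<^bold>\<not> A"] \<Gamma> \<Delta> by (auto simp: mcs_dual)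
    qed
  next
    assume *: "\<forall>A\<in>\<Delta>. Poss m A \<in> \<Gamma>"
    show "\<forall>A. Nec m A \<in> \<Gamma> \<longrightarrow> A \<in> \<Delta>"
    proof (intro allI impI)
      fix A assume "Nec m A \<in> \<Gamma>"
      then show "A \<in> \<Delta>"
        using *[rule_format, of "\<^bold>\<not> A"] \<Gamma> \<Delta> by auto
    qed
  qed
  then show ?thesis
    by (cases "mcs \<Gamma> \<and> mcs \<Delta>") (auto simp: can_acc_def simp del: mcs_Imp)
qed

text \<open>Directedness of \<open>D\<close> under provable implication replaces closure under
  finite conjunctions. The set \<open>?T\<close> is the theory generated by \<open>D\<close> and the
  formulae boxed in \<open>\<Gamma>\<close>. If it contained \<open>Bot\<close>, some
  \<open>B\<close> in \<open>D\<close> would have its negation boxed in \<open>\<Gamma>\<close>,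
  against \<open>Poss m B \<in> \<Gamma>\<close>.\<close>

lemma exists_successor:
  assumes \<Gamma>: "mcs \<Gamma>" and "D \<noteq> {}"
    and directed: "\<And>A B. A \<in> D \<Longrightarrow> B \<in> D \<Longrightarrow> \<exists>C\<in>D. C \<^bold>\<rightarrow> A \<in> M \<and> C \<^bold>\<rightarrow> B \<in> M"
    and Poss: "\<And>A. A \<in> D \<Longrightarrow> Poss m A \<in> \<Gamma>"
  obtains \<Delta> where "(\<Gamma>, \<Delta>) \<in> can_acc m" and "D \<subseteq> \<Delta>"
proof -
  let ?T = "{C. \<exists>B\<in>D. Nec m (B \<^bold>\<rightarrow> C) \<in> \<Gamma>}"
  have Nec_imp: "Nec m B \<in> \<Gamma>" if "A \<^bold>\<rightarrow> B \<in> M" "Nec m A \<in> \<Gamma>" for A B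
    using \<Gamma> mcs_M[OF \<Gamma> nec[OF that(1)]] that(2) by (rule mcs_K)
  have sub: "C \<in> ?T" if "Nec m C \<in> \<Gamma>" for C
  proof -
    obtain B where "B \<in> D" using \<open>D \<noteq> {}\<close> by blast
    moreover have "Nec m (B \<^bold>\<rightarrow> C) \<in> \<Gamma>"
      by (rule Nec_imp[OF _ that]) (simp add: in_M_iff)
    ultimately show ?thesis by blast
  qed
  have D: "D \<subseteq> ?T"
  proof
    fix B assume "B \<in> D"
    moreover have "Nec m (B \<^bold>\<rightarrow> B) \<in> \<Gamma>"
      by (rule mcs_M[OF \<Gamma> nec]) (simp add: in_M_iff)
    ultimately show "B \<in> ?T" by blast
  qed
  have "mp_closed ?T"
    unfolding mp_closed_def
  proof (intro conjI allI impI)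
    show "M \<subseteq> ?T"
      using sub mcs_M[OF \<Gamma> nec] by blast
  next
    fix A B assume "A \<^bold>\<rightarrow> B \<in> ?T" "A \<in> ?T"
    then obtain A' B' where "A' \<in> D" "B' \<in> D"
      and N: "Nec m (A' \<^bold>\<rightarrow> A \<^bold>\<rightarrow> B) \<in> \<Gamma>" "Nec m (B' \<^bold>\<rightarrow> A) \<in> \<Gamma>"
      by blast
    then obtain C where C: "C \<in> D" "C \<^bold>\<rightarrow> A' \<in> M" "C \<^bold>\<rightarrow> B' \<in> M"
      using directed by blast
    have "(A' \<^bold>\<rightarrow> A \<^bold>\<rightarrow> B) \<^bold>\<rightarrow> (B' \<^bold>\<rightarrow> A) \<^bold>\<rightarrow> (C \<^bold>\<rightarrow> B) \<in> M"
      using C(2,3) by (simp add: in_M_iff)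
    from mcs_Nec_mono2[OF \<Gamma> this N] C(1) show "B \<in> ?T" by blast
  qed
  moreover have "Bot \<notin> ?T"
    using Poss \<Gamma> by (auto simp: mcs_dual)
  ultimately obtain \<Delta> where "mcs \<Delta>" "?T \<subseteq> \<Delta>"
    using lindenbaum by blast
  then show ?thesis
    using that[of \<Delta>] sub D \<Gamma> unfolding can_acc_def by blast
qed

lemma Poss_iff:
  assumes "mcs \<Gamma>"
  shows "Poss m A \<in> \<Gamma> \<longleftrightarrow> (\<exists>\<Delta>. (\<Gamma>, \<Delta>) \<in> can_acc m \<and> A \<in> \<Delta>)"
proof
  assume "Poss m A \<in> \<Gamma>"
  then show "\<exists>\<Delta>. (\<Gamma>, \<Delta>) \<in> can_acc m \<and> A \<in> \<Delta>"
    using exists_successor[OF assms, of "{A}" m] by (auto simp: in_M_iff)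
qed (auto simp: can_acc_Poss)

lemma Nec_iff:
  assumes "mcs \<Gamma>"
  shows "Nec m A \<in> \<Gamma> \<longleftrightarrow> (\<forall>\<Delta>. (\<Gamma>, \<Delta>) \<in> can_acc m \<longrightarrow> A \<in> \<Delta>)"
proof -
  have "Nec m A \<in> \<Gamma> \<longleftrightarrow> Poss m (\<^bold>\<not> A) \<notin> \<Gamma>"
    using assms by simp
  also have "\<dots> \<longleftrightarrow> (\<forall>\<Delta>. (\<Gamma>, \<Delta>) \<in> can_acc m \<longrightarrow> A \<in> \<Delta>)"
    unfolding Poss_iff[OF assms] using can_accD by fastforce
  finally show ?thesis .
qed

text \<open>Canonicity for compositions, from which both halves of commutation follow. The
  intermediate point must contain \<open>Poss k A\<close> for all \<open>A\<close> in
  \<open>\<Theta>\<close>; these formulae are directed because \<open>Poss k\<close> of a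
  conjunction implies \<open>Poss k\<close> of each conjunct.\<close>

lemma can_acc_relcomp:
  assumes \<Gamma>: "mcs \<Gamma>" and \<Theta>: "mcs \<Theta>" and Poss: "\<And>A. A \<in> \<Theta> \<Longrightarrow> Poss m (Poss k A) \<in> \<Gamma>"
  shows "(\<Gamma>, \<Theta>) \<in> can_acc m O can_acc k"
proof -
  obtain \<Delta> where \<Delta>: "(\<Gamma>, \<Delta>) \<in> can_acc m" "Poss k ` \<Theta> \<subseteq> \<Delta>"
  proof (rule exists_successor[OF \<Gamma>, of "Poss k ` \<Theta>" m])
    have "Bot \<^bold>\<rightarrow> Bot \<in> \<Theta>" using \<Theta> by simp
    then show "Poss k ` \<Theta> \<noteq> {}" by blast
  next
    fix A B assume "A \<in> Poss k ` \<Theta>" "B \<in> Poss k ` \<Theta>"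
    then obtain A' B' where AB: "A = Poss k A'" "B = Poss k B'" "A' \<in> \<Theta>" "B' \<in> \<Theta>"
      by blast
    let ?C = "A' \<^bold>\<and> B'"
    have "?C \<in> \<Theta>" using AB \<Theta> by simp
    moreover have "Poss k ?C \<^bold>\<rightarrow> A \<in> M" "Poss k ?C \<^bold>\<rightarrow> B \<in> M"
      unfolding in_M_iff AB using can_accD by (fastforce simp: Poss_iff)+
    ultimately show "\<exists>C\<in>Poss k ` \<Theta>. C \<^bold>\<rightarrow> A \<in> M \<and> C \<^bold>\<rightarrow> B \<in> M"
      by blast
  qed (use Poss in auto)
  have "(\<Delta>, \<Theta>) \<in> can_acc k"
    using \<Delta> \<Theta> can_accD[OF \<Delta>(1)] by (auto simp: can_acc_Poss)
  with \<Delta>(1) show ?thesis by blast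
qed

lemma canonical_truth:
  "mcs \<Gamma> \<Longrightarrow> sat canonical (\<lambda>i. {\<Gamma>. Var i \<in> \<Gamma>}) \<Gamma> A \<longleftrightarrow> A \<in> \<Gamma>"
proof (induction A arbitrary: \<Gamma>)
  case (Poss m A)
  have "sat canonical (\<lambda>i. {\<Gamma>. Var i \<in> \<Gamma>}) \<Gamma> (Poss m A) \<longleftrightarrow>
      (\<exists>\<Delta>. mcs \<Delta> \<and> (\<Gamma>, \<Delta>) \<in> can_acc m \<and> sat canonical (\<lambda>i. {\<Gamma>. Var i \<in> \<Gamma>}) \<Delta> A)"
    by (auto simp: canonical_def)
  also have "\<dots> \<longleftrightarrow> (\<exists>\<Delta>. (\<Gamma>, \<Delta>) \<in> can_acc m \<and> A \<in> \<Delta>)"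
    using Poss.IH can_accD by metis
  finally show ?case
    using Poss_iff[OF Poss.prems] by blast
qed simp_all

end

section \<open>The canonical frame of the commutator\<close>

instance bimodality :: countable by countable_datatype
instance fm :: (countable) countable by countable_datatype

text \<open>The fusion contains only translated unimodal theorems, so bimodal tautologies have to be
  derived. Coding variables and modal subformulae as variables gives a unimodal tautology, and
  substituting \<open>from_nat\<close> restores the original formula.\<close>

primrec skeleton :: "'m::countable fm \<Rightarrow> unit fm" where
  "skeleton (Var i) = Var (to_nat (Var i :: 'm fm))"
| "skeleton Bot = Bot"
| "skeleton (A \<^bold>\<rightarrow> B) = skeleton A \<^bold>\<rightarrow> skeleton B"
| "skeleton (Poss m A) = Var (to_nat (Poss m A))"

lemma subst_skeleton: "subst from_nat (map_fm f (skeleton A)) = A"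
  by (induction A) auto

lemma bool_eval_skeleton:
  "bool_eval e (skeleton A) = bool_eval (\<lambda>a. e (Var (to_nat a))) A"
  by (induction A) auto

lemma skeleton_tautology: "A \<in> tautologies \<Longrightarrow> skeleton A \<in> tautologies"
  by (simp add: tautologies_def bool_eval_skeleton)

locale commutator_GL =
  fixes n :: nat
  assumes n: "n \<ge> 1"
begin

abbreviation M :: "bimodality fm set" where
  "M \<equiv> commutator_S5 (GL_depth n)"

lemma M_subst: "A \<in> M \<Longrightarrow> subst s A \<in> M"
  unfolding commutator_S5_def by (rule rule_closure.Subst)

lemma M_base:
  "A \<in> GL_depth n \<Longrightarrow> map_fm (\<lambda>_. Dia) A \<in> M"
  "A \<in> S5 \<Longrightarrow> map_fm (\<lambda>_. Ex) A \<in> M"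
  unfolding commutator_S5_def fusion_S5_def by (auto intro!: rule_closure.base)

lemma M_K_axioms:
  assumes "A \<in> K_axioms"
  shows "map_fm (\<lambda>_. m) A \<in> M"
  using assms M_base
  by (cases m) (auto simp: GL_depth_def S5_def K_plus_def intro: rule_closure.base)

lemma M_subst_K_axioms: "A \<in> K_axioms \<Longrightarrow> subst s (map_fm (\<lambda>_. m) A) \<in> M"
  by (intro M_subst M_K_axioms)

sublocale normal_logic M
proof
  show "tautologies \<subseteq> M"
  proof
    fix A :: "bimodality fm" assume "A \<in> tautologies"
    then have "skeleton A \<in> GL_depth n"
      unfolding GL_depth_def K_plus_def
      by (auto intro: rule_closure.base skeleton_tautology)
    then show "A \<in> M"
      using M_subst[OF M_base(1), of "skeleton A" from_nat] by (simp add: subst_skeleton)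
  qed
  show "B \<in> M" if "A \<^bold>\<rightarrow> B \<in> M" "A \<in> M" for A B
    using that unfolding commutator_S5_def by (rule rule_closure.MP)
  show "Nec m A \<in> M" if "A \<in> M" for A m
    using that unfolding commutator_S5_def by (rule rule_closure.Necessitation)
  fix A B :: "bimodality fm" and m
  let ?s = "(\<lambda>_. B)(0 := A)"
  have "Nec () (Var 0 \<^bold>\<rightarrow> Var 1) \<^bold>\<rightarrow> Nec () (Var 0) \<^bold>\<rightarrow> Nec () (Var 1) \<in> K_axioms"
    "Poss () (Var 0) \<^bold>\<rightarrow> \<^bold>\<not> Nec () (\<^bold>\<not> Var 0) \<in> K_axioms"
    "\<^bold>\<not> Nec () (\<^bold>\<not> Var 0) \<^bold>\<rightarrow> Poss () (Var 0) \<in> K_axioms"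
    by (simp_all add: K_axioms_def)
  from this[THEN M_subst_K_axioms, of ?s m] show
    "Nec m (A \<^bold>\<rightarrow> B) \<^bold>\<rightarrow> Nec m A \<^bold>\<rightarrow> Nec m B \<in> M"
    "Poss m A \<^bold>\<rightarrow> \<^bold>\<not> Nec m (\<^bold>\<not> A) \<in> M"
    "\<^bold>\<not> Nec m (\<^bold>\<not> A) \<^bold>\<rightarrow> Poss m A \<in> M"
    by simp_all
qed

lemma lob: "Nec Dia (Nec Dia A \<^bold>\<rightarrow> A) \<^bold>\<rightarrow> Nec Dia A \<in> M"
proof -
  have "GL_axiom \<in> GL_depth n"
    by (simp add: GL_depth_def K_plus_def rule_closure.base)
  from M_subst[OF M_base(1)[OF this], of "\<lambda>_. A"] show ?thesis
    by (simp add: GL_axiom_def)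
qed

text \<open>Loeb's axiom as an induction principle: to box \<open>A\<close> at
  \<open>\<Gamma>\<close>, one may assume \<open>Nec Dia A\<close> at each successor while proving
  \<open>A\<close> there.\<close>

lemma mcs_lob:
  assumes "mcs \<Gamma>" and "\<And>\<Delta>. (\<Gamma>, \<Delta>) \<in> can_acc Dia \<Longrightarrow> Nec Dia A \<in> \<Delta> \<Longrightarrow> A \<in> \<Delta>"
  shows "Nec Dia A \<in> \<Gamma>"
proof -
  have "Nec Dia (Nec Dia A \<^bold>\<rightarrow> A) \<in> \<Gamma>"
    unfolding Nec_iff[OF assms(1)] using assms(2) can_accD mcs_Imp by metis
  then show ?thesis
    using mcs_M[OF assms(1) lob[of A]] mcs_Imp[OF assms(1)] by metis
qed

lemma bd_instance: "subst s (map_fm (\<lambda>_. Dia) (bd n)) \<in> M"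
  by (intro M_subst M_base(1)) (simp add: GL_depth_def K_plus_def rule_closure.base)

lemma S5_instances:
  "A \<^bold>\<rightarrow> Poss Ex A \<in> M"
  "Poss Ex (Poss Ex A) \<^bold>\<rightarrow> Poss Ex A \<in> M"
  "Poss Ex A \<^bold>\<rightarrow> Nec Ex (Poss Ex A) \<in> M"
proof -
  have *: "Var 0 \<^bold>\<rightarrow> Poss () (Var 0) \<in> S5"
    "Poss () (Poss () (Var 0)) \<^bold>\<rightarrow> Poss () (Var 0) \<in> S5"
    "Poss () (Var 0) \<^bold>\<rightarrow> Nec () (Poss () (Var 0)) \<in> S5"
    by (auto simp: S5_def K_plus_def intro: rule_closure.base)
  from *[THEN M_base(2), THEN M_subst, of "\<lambda>_. A"] show
    "A \<^bold>\<rightarrow> Poss Ex A \<in> M"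
    "Poss Ex (Poss Ex A) \<^bold>\<rightarrow> Poss Ex A \<in> M"
    "Poss Ex A \<^bold>\<rightarrow> Nec Ex (Poss Ex A) \<in> M"
    by simp_all
qed

lemma commutator_instances:
  "Poss Ex (Poss Dia A) \<^bold>\<rightarrow> Poss Dia (Poss Ex A) \<in> M"
  "Poss Dia (Poss Ex A) \<^bold>\<rightarrow> Poss Ex (Poss Dia A) \<in> M"
proof -
  have "Poss Ex (Poss Dia (Var 0)) \<^bold>\<rightarrow> Poss Dia (Poss Ex (Var 0)) \<in> M"
    "Poss Dia (Poss Ex (Var 0)) \<^bold>\<rightarrow> Poss Ex (Poss Dia (Var 0)) \<in> M"
    by (auto simp: commutator_S5_def intro: rule_closure.base)
  from this[THEN M_subst, of "\<lambda>_. A"] show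
    "Poss Ex (Poss Dia A) \<^bold>\<rightarrow> Poss Dia (Poss Ex A) \<in> M"
    "Poss Dia (Poss Ex A) \<^bold>\<rightarrow> Poss Ex (Poss Dia A) \<in> M"
    by simp_all
qed

lemma trans_Dia: "trans (can_acc Dia)"
proof (rule transI)
  fix \<Gamma> \<Delta> \<Theta> assume \<Gamma>\<Delta>: "(\<Gamma>, \<Delta>) \<in> can_acc Dia" and \<Delta>\<Theta>: "(\<Delta>, \<Theta>) \<in> can_acc Dia"
  then have mcs: "mcs \<Gamma>" "mcs \<Delta>" "mcs \<Theta>"
    using can_accD by blast+
  have "A \<in> \<Theta>" if A: "Nec Dia A \<in> \<Gamma>" for A
  proof -
    \<comment> \<open>The classical derivation of transitivity from Loeb's axiom: strengthening
      \<open>A\<close> by its own box makes the Loeb induction go through.\<close>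
    let ?B = "A \<^bold>\<and> Nec Dia A"
    have "Nec Dia ?B \<in> \<Gamma>"
    proof (rule mcs_lob[OF mcs(1)])
      fix \<Lambda> assume \<Lambda>: "(\<Gamma>, \<Lambda>) \<in> can_acc Dia" and B: "Nec Dia ?B \<in> \<Lambda>"
      have m: "mcs \<Lambda>" using can_accD[OF \<Lambda>] by blast
      have "Nec Dia A \<in> \<Lambda>"
        unfolding Nec_iff[OF m]
      proof (intro allI impI)
        fix \<Xi> assume \<Xi>: "(\<Lambda>, \<Xi>) \<in> can_acc Dia"
        then have "?B \<in> \<Xi>" using B Nec_iff[OF m] by blast
        then show "A \<in> \<Xi>" using can_accD[OF \<Xi>] by simp
      qed
      moreover have "A \<in> \<Lambda>"
        using A \<Lambda> Nec_iff[OF mcs(1)] by blast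
      ultimately show "?B \<in> \<Lambda>"
        using m by simp
    qed
    then have "?B \<in> \<Delta>"
      using \<Gamma>\<Delta> Nec_iff[OF mcs(1)] by blast
    then have "Nec Dia A \<in> \<Delta>"
      using mcs(2) by simp
    then show ?thesis
      using \<Delta>\<Theta> Nec_iff[OF mcs(2)] by blast
  qed
  then show "(\<Gamma>, \<Theta>) \<in> can_acc Dia"
    using mcs by (simp add: can_acc_def)
qed

lemma equiv_Ex: "equiv {\<Gamma>. mcs \<Gamma>} (can_acc Ex)"
proof (rule equivI)
  show "can_acc Ex \<subseteq> {\<Gamma>. mcs \<Gamma>} \<times> {\<Gamma>. mcs \<Gamma>}"
    by (auto dest: can_accD)
  show "refl_on {\<Gamma>. mcs \<Gamma>} (can_acc Ex)"
    using mcs_M[OF _ S5_instances(1)] by (auto simp: refl_on_def can_acc_Poss)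
  show "sym (can_acc Ex)"
  proof (rule symI)
    fix \<Gamma> \<Delta> assume \<Gamma>\<Delta>: "(\<Gamma>, \<Delta>) \<in> can_acc Ex"
    then have mcs: "mcs \<Gamma>" "mcs \<Delta>"
      using can_accD by blast+
    have "Poss Ex A \<in> \<Delta>" if "A \<in> \<Gamma>" for A
    proof -
      have "Nec Ex (Poss Ex A) \<in> \<Gamma>"
        using mcs_M[OF mcs(1) S5_instances(1)[of A]] mcs_M[OF mcs(1) S5_instances(3)[of A]]
          mcs_Imp[OF mcs(1)] that by metis
      then show ?thesis
        using \<Gamma>\<Delta> Nec_iff[OF mcs(1)] by blast
    qed
    then show "(\<Delta>, \<Gamma>) \<in> can_acc Ex"
      using mcs by (simp add: can_acc_Poss)
  qed
  show "trans (can_acc Ex)"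
  proof (rule transI)
    fix \<Gamma> \<Delta> \<Theta> assume "(\<Gamma>, \<Delta>) \<in> can_acc Ex" "(\<Delta>, \<Theta>) \<in> can_acc Ex"
    then show "(\<Gamma>, \<Theta>) \<in> can_acc Ex"
      using mcs_M[OF _ S5_instances(2)] by (auto simp: can_acc_Poss)
  qed
qed

lemma can_acc_commute: "can_acc Ex O can_acc Dia = can_acc Dia O can_acc Ex"
proof (intro equalityI subrelI)
  fix \<Gamma> \<Theta> assume "(\<Gamma>, \<Theta>) \<in> can_acc Ex O can_acc Dia"
  then show "(\<Gamma>, \<Theta>) \<in> can_acc Dia O can_acc Ex"
    using mcs_M[OF _ commutator_instances(1)]
    by (intro can_acc_relcomp) (auto simp: can_acc_Poss)
next
  fix \<Gamma> \<Theta> assume "(\<Gamma>, \<Theta>) \<in> can_acc Dia O can_acc Ex"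
  then show "(\<Gamma>, \<Theta>) \<in> can_acc Ex O can_acc Dia"
    using mcs_M[OF _ commutator_instances(2)]
    by (intro can_acc_relcomp) (auto simp: can_acc_Poss)
qed

section \<open>Bounded depth of the canonical frame\<close>

definition box_bot :: "nat \<Rightarrow> bimodality fm" where
  "box_bot k = (Nec Dia ^^ k) Bot"

lemma box_bot_0 [simp]: "box_bot 0 = Bot"
  by (simp add: box_bot_def)

lemma box_bot_Suc_eq: "box_bot (Suc k) = Nec Dia (box_bot k)"
  by (simp add: box_bot_def)

lemma box_bot_Suc:
  "mcs \<Gamma> \<Longrightarrow> box_bot (Suc k) \<in> \<Gamma> \<longleftrightarrow> (\<forall>\<Delta>. (\<Gamma>, \<Delta>) \<in> can_acc Dia \<longrightarrow> box_bot k \<in> \<Delta>)"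
  unfolding box_bot_Suc_eq by (rule Nec_iff)

lemma box_bot_mono: "mcs \<Gamma> \<Longrightarrow> box_bot k \<in> \<Gamma> \<Longrightarrow> box_bot (Suc k) \<in> \<Gamma>"
proof (induction k arbitrary: \<Gamma>)
  case (Suc k)
  then show ?case
    using can_accD box_bot_Suc by meson
qed simp

text \<open>The points containing \<open>box_bot (Suc k)\<close> but not \<open>box_bot k\<close> are those of depth exactly
  \<open>k + 1\<close>; the term \<open>i - 1\<close> is harmless because \<open>bd k\<close> has only the variables 1 to \<open>k\<close>.\<close>

lemma bd_fails:
  "mcs \<Gamma> \<Longrightarrow> k \<ge> 1 \<Longrightarrow> box_bot (Suc k) \<in> \<Gamma> \<Longrightarrow> box_bot k \<notin> \<Gamma> \<Longrightarrow>
    subst (\<lambda>i. box_bot (i - 1)) (map_fm (\<lambda>_. Dia) (bd k)) \<notin> \<Gamma>"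
proof (induction k arbitrary: \<Gamma> rule: bd.induct)
  case 1
  then show ?case by simp
next
  case 2
  then obtain \<Delta> where \<Delta>: "(\<Gamma>, \<Delta>) \<in> can_acc Dia" "box_bot 1 \<in> \<Delta>"
    using box_bot_Suc[of \<Gamma> 0] box_bot_Suc[of \<Gamma> 1] can_accD by fastforce
  then have "Poss Dia (Nec Dia Bot) \<in> \<Gamma>"
    using 2(1) Poss_iff by (metis One_nat_def box_bot_0 box_bot_Suc_eq)
  then show ?case
    using 2(1) by simp
next
  case (3 k)
  let ?s = "\<lambda>i. box_bot (i - 1)"
  let ?B = "subst ?s (map_fm (\<lambda>_. Dia) (bd (Suc k)))"
  let ?C = "Nec Dia (box_bot (Suc k)) \<^bold>\<and> \<^bold>\<not> ?B"
  \<comment> \<open>A successor of depth exactly one less than that of \<open>\<Gamma>\<close>, so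
    that the induction hypothesis refutes the inner \<open>bd\<close> there.\<close>
  obtain \<Delta> where \<Delta>: "(\<Gamma>, \<Delta>) \<in> can_acc Dia" "box_bot (Suc k) \<notin> \<Delta>"
    using 3 box_bot_Suc by blast
  have m: "mcs \<Delta>" using can_accD[OF \<Delta>(1)] by blast
  have \<Delta>2: "box_bot (Suc (Suc k)) \<in> \<Delta>"
    using 3 \<Delta>(1) box_bot_Suc by blast
  then have "?B \<notin> \<Delta>"
    using 3(1)[OF m] \<Delta>(2) by simp
  then have "?C \<in> \<Delta>"
    using \<Delta>2 m by (simp add: box_bot_Suc_eq)
  then have "Poss Dia ?C \<in> \<Gamma>"
    using \<Delta>(1) Poss_iff[OF 3(2)] by blast
  moreover have "box_bot (Suc k) \<notin> \<Gamma>"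
    using 3 box_bot_mono by blast
  ultimately show ?case
    using 3(2) by simp
qed

text \<open>The instance of \<open>bd n\<close> excludes depth exactly \<open>n + 1\<close>, so
  \<open>box_bot (Suc n)\<close> forces \<open>box_bot n\<close> at every point. This is the premise
  of Loeb induction for \<open>box_bot n\<close>, which thereby excludes larger and infinite depth
  as well.\<close>

lemma box_bot_n:
  assumes "mcs \<Gamma>"
  shows "box_bot n \<in> \<Gamma>"
proof -
  have *: "box_bot n \<in> \<Delta>" if "mcs \<Delta>" "box_bot (Suc n) \<in> \<Delta>" for \<Delta>
    using bd_fails[OF that(1) n that(2)] mcs_M[OF that(1) bd_instance] by blast
  have "Nec Dia (box_bot n) \<in> \<Gamma>"
    by (rule mcs_lob[OF assms]) (use * can_accD box_bot_Suc_eq in metis)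
  then show ?thesis
    using *[OF assms] by (simp add: box_bot_Suc_eq)
qed

text \<open>The number of points on a longest \<open>Dia\<close>-chain from \<open>\<Gamma>\<close>,
  the start included; it is never 0 because \<open>box_bot 0\<close> is \<open>Bot\<close>.\<close>

definition depth :: "bimodality fm set \<Rightarrow> nat" where
  "depth \<Gamma> = (LEAST k. box_bot k \<in> \<Gamma>)"

lemma depth_bounds:
  assumes "mcs \<Gamma>"
  shows "1 \<le> depth \<Gamma>" and "depth \<Gamma> \<le> n"
proof -
  have "box_bot (depth \<Gamma>) \<in> \<Gamma>"
    unfolding depth_def by (rule LeastI) (rule box_bot_n[OF assms])
  then show "1 \<le> depth \<Gamma>"
    using assms by (cases "depth \<Gamma>") auto
  show "depth \<Gamma> \<le> n"
    unfolding depth_def by (rule Least_le) (rule box_bot_n[OF assms])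
qed

lemma depth_less:
  assumes "(\<Gamma>, \<Delta>) \<in> can_acc Dia"
  shows "depth \<Delta> < depth \<Gamma>"
proof -
  have m: "mcs \<Gamma>" using can_accD[OF assms] by blast
  have "box_bot (depth \<Gamma>) \<in> \<Gamma>"
    unfolding depth_def by (rule LeastI) (rule box_bot_n[OF m])
  moreover obtain k where k: "depth \<Gamma> = Suc k"
    using depth_bounds(1)[OF m] by (cases "depth \<Gamma>") auto
  ultimately have "box_bot k \<in> \<Delta>"
    using box_bot_Suc[OF m] assms by simp
  then have "depth \<Delta> \<le> k"
    unfolding depth_def by (rule Least_le)
  with k show ?thesis by simp
qed

end

section \<open>Unravelling into a product\<close>

locale commuting_frame =
  fixes X :: "'w set" and R E :: "('w \<times> 'w) set" and r :: 'w
  assumes R_sub: "R \<subseteq> X \<times> X" and trans_R: "trans R"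
    and equiv_E: "equiv X E" and commute: "E O R = R O E"
    and r: "r \<in> X"
begin

text \<open>Nodes are branches written from tip to root; the root \<open>[]\<close> is labelled \<open>r\<close>.
  The label of a node matters only up to \<open>E\<close>, and each child occurs
  infinitely often (the \<open>nat\<close> component).\<close>

primrec label :: "('w \<times> nat) list \<Rightarrow> 'w" where
  "label [] = r"
| "label (a # l) = fst a"

text \<open>By commutation, which \<open>w\<close> satisfy \<open>(label l, w) \<in> R O E\<close>
  depends only on the \<open>E\<close>-class of \<open>label l\<close>.\<close>

primrec node :: "('w \<times> nat) list \<Rightarrow> bool" where
  "node [] = True"
| "node (a # l) = (node l \<and> (label l, fst a) \<in> R O E)"

text \<open>A section is a bounded morphism from the tree of nodes; the existence of a child sent to
  \<open>w\<close> is all that the back condition needs.\<close>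

definition section_map :: "(('w \<times> nat) list \<Rightarrow> 'w) \<Rightarrow> bool" where
  "section_map g \<longleftrightarrow>
    (\<forall>l. node l \<longrightarrow> (g l, label l) \<in> E) \<and>
    (\<forall>a l. node (a # l) \<longrightarrow> (g l, g (a # l)) \<in> R) \<and>
    (\<forall>l w. node l \<longrightarrow> (g l, w) \<in> R \<longrightarrow> (\<exists>k. g ((w, k) # l) = w))"

lemma section_label: "section_map g \<Longrightarrow> node l \<Longrightarrow> (g l, label l) \<in> E"
  by (simp add: section_map_def)

lemma section_step: "section_map g \<Longrightarrow> node (a # l) \<Longrightarrow> (g l, g (a # l)) \<in> R"
  unfolding section_map_def by blast

text \<open>The partial map \<open>p\<close> prescribes values along one branch; elsewhere the child
  labelled \<open>w\<close> is sent to \<open>w\<close> itself whenever this is possible.\<close>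

primrec fill :: "(('w \<times> nat) list \<rightharpoonup> 'w) \<Rightarrow> ('w \<times> nat) list \<Rightarrow> 'w" where
  "fill p [] = (case p [] of Some z \<Rightarrow> z | None \<Rightarrow> r)"
| "fill p (a # l) = (case p (a # l) of Some z \<Rightarrow> z
     | None \<Rightarrow> if (fill p l, fst a) \<in> R then fst a
              else SOME v. (fill p l, v) \<in> R \<and> (v, fst a) \<in> E)"

text \<open>The last clause closes the domain under parents, so a prescribed value never has to fit
  a parent value chosen by \<open>fill\<close>. Finiteness keeps infinitely many copies of every
  child free.\<close>

definition prescription :: "(('w \<times> nat) list \<rightharpoonup> 'w) \<Rightarrow> bool" where
  "prescription p \<longleftrightarrow> finite (dom p) \<and>
    (\<forall>l z. p l = Some z \<longrightarrow> (z, label l) \<in> E) \<and>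
    (\<forall>a l z. p (a # l) = Some z \<longrightarrow> (\<exists>y. p l = Some y \<and> (y, z) \<in> R))"

lemma E_refl: "x \<in> X \<Longrightarrow> (x, x) \<in> E"
  using equiv_E by (simp add: equiv_def refl_on_def)

lemma E_sym: "(x, y) \<in> E \<Longrightarrow> (y, x) \<in> E"
  using equiv_E by (meson equivE symD)

lemma E_trans: "(x, y) \<in> E \<Longrightarrow> (y, z) \<in> E \<Longrightarrow> (x, z) \<in> E"
  using equiv_E by (meson equivE transD)

lemma E_in: "(x, y) \<in> E \<Longrightarrow> x \<in> X"
  using equiv_E unfolding equiv_def by blast

lemma node_label_in: "node l \<Longrightarrow> label l \<in> X"
  using r by (cases l) (auto dest: E_sym E_in)

lemma fill_Some: "p l = Some z \<Longrightarrow> fill p l = z"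
  by (cases l) auto

lemma fill_correct:
  assumes "prescription p"
  shows "node l \<Longrightarrow> (fill p l, label l) \<in> E"
    and "node (a # l) \<Longrightarrow> (fill p l, fill p (a # l)) \<in> R"
proof -
  have step: "(fill p l, fill p (a # l)) \<in> R \<and> (fill p (a # l), label (a # l)) \<in> E"
    if IH: "(fill p l, label l) \<in> E" and node: "node (a # l)" for a l
  proof (cases "p (a # l)")
    case None
    \<comment> \<open>Commutation transports the step from \<open>label l\<close> to the
      \<open>E\<close>-equivalent point \<open>fill p l\<close>, so the choice made by
      \<open>SOME\<close> is realised.\<close>
    have "(label l, fst a) \<in> R O E" using node by simp
    then obtain u where "(label l, u) \<in> R" "(u, fst a) \<in> E" by blast
    then obtain v where "(fill p l, v) \<in> R" "(v, u) \<in> E"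
      using IH commute by blast
    then have v: "\<exists>v. (fill p l, v) \<in> R \<and> (v, fst a) \<in> E"
      using \<open>(u, fst a) \<in> E\<close> E_trans by blast
    show ?thesis
      using None someI_ex[OF v] node_label_in[OF node] by (auto intro: E_refl)
  next
    case (Some z)
    then obtain y where "p l = Some y" "(y, z) \<in> R" "(z, label (a # l)) \<in> E"
      using assms unfolding prescription_def by blast
    then show ?thesis
      using Some fill_Some by metis
  qed
  show *: "(fill p l, label l) \<in> E" if "node l" for l
    using that
  proof (induction l)
    case Nil
    then show ?case
      using assms E_refl[OF r]
      by (auto simp: prescription_def split: option.split) (metis label.simps(1))
  next
    case (Cons a l)
    then show ?case using step by auto
  qed
  show "(fill p l, fill p (a # l)) \<in> R" if "node (a # l)"
    using step[OF * that] that by simp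
qed

lemma section_map_fill:
  assumes "prescription p"
  shows "section_map (fill p)"
  unfolding section_map_def
proof (intro conjI allI impI)
  fix l w assume "node l" and R: "(fill p l, w) \<in> R"
  \<comment> \<open>Back condition: only finitely many copies of the child labelled \<open>w\<close>
    are prescribed, and a free copy is sent to \<open>w\<close> itself.\<close>
  have "finite ((\<lambda>k. (w, k) # l) -` dom p)"
    using assms by (intro finite_vimageI) (auto simp: prescription_def inj_on_def)
  then obtain k where "(w, k) # l \<notin> dom p"
    using ex_new_if_finite[OF infinite_UNIV_nat] by (metis vimageI)
  then have "fill p ((w, k) # l) = w"
    using R by (simp add: domIff)
  then show "\<exists>k. fill p ((w, k) # l) = w" by blast
qed (use fill_correct[OF assms] in blast)+

text \<open>Values are chosen from the tip towards the root: commutation finds, below any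
  \<open>z\<close> in the \<open>E\<close>-class of the tip, a predecessor in the
  \<open>E\<close>-class of its parent's label. The length bound serves the induction.\<close>

lemma exists_prescription:
  "node l \<Longrightarrow> (z, label l) \<in> E \<Longrightarrow>
    \<exists>p. prescription p \<and> p l = Some z \<and> (\<forall>l'\<in>dom p. length l' \<le> length l)"
proof (induction l arbitrary: z)
  case Nil
  let ?p = "\<lambda>l :: ('w \<times> nat) list. if l = [] then Some z else None"
  have "dom ?p = {[]}" by (auto simp: dom_def)
  with Nil show ?case
    by (intro exI[of _ ?p]) (simp add: prescription_def)
next
  case (Cons a l)
  then obtain u where u: "(label l, u) \<in> R" "(u, fst a) \<in> E" "(z, fst a) \<in> E"
    by auto
  then have "(label l, z) \<in> E O R"
    unfolding commute using E_trans[OF u(2) E_sym[OF u(3)]] by blast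
  then obtain y where y_E: "(label l, y) \<in> E" and y_R: "(y, z) \<in> R"
    by blast
  obtain p where p: "prescription p" "p l = Some y" "\<forall>l'\<in>dom p. length l' \<le> length l"
    using Cons.IH[OF _ E_sym[OF y_E]] Cons.prems by auto
  let ?p = "p(a # l \<mapsto> z)"
  \<comment> \<open>No child of the new node is prescribed yet, so defining \<open>p\<close> at
    \<open>a # l\<close> cannot break the parent clause.\<close>
  have new: "p (b # a # l) = None" for b
    using p(3) by (metis domI impossible_Cons length_Cons not_None_eq Suc_leD)
  have "prescription ?p"
    unfolding prescription_def
  proof (intro conjI allI impI)
    show "finite (dom ?p)" using p(1) by (simp add: prescription_def)
    show "(v, label l') \<in> E" if "?p l' = Some v" for l' v
      using that p(1) Cons.prems(2) by (auto simp: prescription_def split: if_splits)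
    show "\<exists>u. ?p l' = Some u \<and> (u, v) \<in> R" if "?p (b # l') = Some v" for b l' v
    proof (cases "b # l' = a # l")
      case True
      then show ?thesis using that p(2) y_R by auto
    next
      case False
      then have *: "p (b # l') = Some v" using that by (simp split: if_splits)
      then have "l' \<noteq> a # l" using new[of b] by auto
      moreover obtain u where "p l' = Some u" "(u, v) \<in> R"
        using * p(1) unfolding prescription_def by blast
      ultimately show ?thesis by auto
    qed
  qed
  moreover have "\<forall>l'\<in>dom ?p. length l' \<le> length (a # l)"
    using p(3) by (auto simp: le_SucI)
  moreover have "?p (a # l) = Some z" by simp
  ultimately show ?case by blast
qed

lemma exists_section:
  assumes "node l" and "(z, label l) \<in> E"
  obtains g where "section_map g" and "g l = z"
  using exists_prescription[OF assms] section_map_fill fill_Some by metis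

text \<open>Since nodes are written tip first, the descendants of \<open>l\<close> are the nodes
  having \<open>l\<close> as a proper suffix.\<close>

definition tree :: "(('w \<times> nat) list \<times> ('w \<times> nat) list) set" where
  "tree = {(l, l'). node l' \<and> (\<exists>s. s \<noteq> [] \<and> l' = s @ l)}"

lemma trans_tree: "trans tree"
proof (rule transI)
  fix l1 l2 l3 assume "(l1, l2) \<in> tree" "(l2, l3) \<in> tree"
  then obtain s t where "s \<noteq> []" "node l3" "l3 = (t @ s) @ l1"
    unfolding tree_def by fastforce
  then show "(l1, l3) \<in> tree"
    unfolding tree_def by blast
qed

lemma tree_section:
  assumes "section_map g" and "(l, l') \<in> tree"
  shows "(g l, g l') \<in> R"
proof -
  have "node (s @ l) \<Longrightarrow> s \<noteq> [] \<Longrightarrow> (g l, g (s @ l)) \<in> R" for s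
  proof (induction s)
    case (Cons a s)
    then have "(g (s @ l), g (a # s @ l)) \<in> R"
      using section_step[OF assms(1), of a "s @ l"] by simp
    with Cons show ?case
      using transD[OF trans_R] by (cases "s = []") auto
  qed simp
  then show ?thesis
    using assms(2) by (auto simp: tree_def)
qed

lemma tree_successor:
  assumes "section_map g" and "node l" and "(g l, w) \<in> R"
  obtains l' where "node l'" and "(l, l') \<in> tree" and "g l' = w"
proof -
  obtain k where k: "g ((w, k) # l) = w"
    using assms unfolding section_map_def by blast
  \<comment> \<open>The point \<open>w\<close> is an \<open>R\<close>-successor of
    \<open>g l\<close> and not of \<open>label l\<close>; commutation makes it an admissible label
    of a child all the same.\<close>
  have "(label l, w) \<in> R O E"
    using assms(3) E_sym[OF section_label[OF assms(1,2)]] unfolding commute[symmetric] by blast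
  then have n: "node ((w, k) # l)" using assms(2) by simp
  moreover have "(w, k) # l = [(w, k)] @ l" by simp
  ultimately have "(l, (w, k) # l) \<in> tree"
    unfolding tree_def by blast
  then show ?thesis
    using that n k by blast
qed

lemma section_E:
  "section_map g \<Longrightarrow> section_map h \<Longrightarrow> node l \<Longrightarrow> (g l, h l) \<in> E"
  by (rule E_trans[OF section_label E_sym[OF section_label]])

end

section \<open>Countable subproducts and frames on arbitrary infinite types\<close>

text \<open>A two-sorted Loewenheim-Skolem argument: the two factors are closed simultaneously,
  since a witness in either one depends on a pair from both. The index \<open>i\<close> will range
  over formulae.\<close>

lemma countable_subproduct:
  fixes P :: "'i::countable \<Rightarrow> 'f \<Rightarrow> 'g \<Rightarrow> 'f \<Rightarrow> bool" and Q :: "'i \<Rightarrow> 'f \<Rightarrow> 'g \<Rightarrow> 'g \<Rightarrow> bool"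
  assumes "x0 \<in> F" and "u0 \<in> G"
  obtains A B where "countable A" and "countable B" and "A \<subseteq> F" and "B \<subseteq> G"
    and "x0 \<in> A" and "u0 \<in> B"
    and "\<And>i x u y. x \<in> A \<Longrightarrow> u \<in> B \<Longrightarrow> y \<in> F \<Longrightarrow> P i x u y \<Longrightarrow> \<exists>y\<in>A. P i x u y"
    and "\<And>i x u v. x \<in> A \<Longrightarrow> u \<in> B \<Longrightarrow> v \<in> G \<Longrightarrow> Q i x u v \<Longrightarrow> \<exists>v\<in>B. Q i x u v"
proof -
  \<comment> \<open>Skolem functions for the two factors, with the base points as values where no
    witness exists.\<close>
  define p where "p i x u = (if \<exists>y\<in>F. P i x u y then SOME y. y \<in> F \<and> P i x u y else x0)" for i x u
  define q where "q i x u = (if \<exists>v\<in>G. Q i x u v then SOME v. v \<in> G \<and> Q i x u v else u0)" for i x u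
  have p: "p i x u \<in> F" "y \<in> F \<Longrightarrow> P i x u y \<Longrightarrow> P i x u (p i x u)" for i x u y
    using someI_ex[of "\<lambda>y. y \<in> F \<and> P i x u y"] assms(1) by (auto simp: p_def)
  have q: "q i x u \<in> G" "v \<in> G \<Longrightarrow> Q i x u v \<Longrightarrow> Q i x u (q i x u)" for i x u v
    using someI_ex[of "\<lambda>v. v \<in> G \<and> Q i x u v"] assms(2) by (auto simp: q_def)
  define step where "step = (\<lambda>(A, B).
    (A \<union> (\<lambda>(i, x, u). p i x u) ` (UNIV \<times> A \<times> B), B \<union> (\<lambda>(i, x, u). q i x u) ` (UNIV \<times> A \<times> B)))"
  define S where "S k = (step ^^ k) ({x0}, {u0})" for k
  have S0: "S 0 = ({x0}, {u0})" by (simp add: S_def)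
  have S_Suc: "fst (S (Suc k)) = fst (S k) \<union> (\<lambda>(i, x, u). p i x u) ` (UNIV \<times> fst (S k) \<times> snd (S k))"
    "snd (S (Suc k)) = snd (S k) \<union> (\<lambda>(i, x, u). q i x u) ` (UNIV \<times> fst (S k) \<times> snd (S k))" for k
    by (simp_all add: S_def step_def split_beta)
  have inv: "countable (fst (S k)) \<and> countable (snd (S k)) \<and> fst (S k) \<subseteq> F \<and> snd (S k) \<subseteq> G" for k
  proof (induction k)
    case 0
    then show ?case using assms by (simp add: S0)
  next
    case (Suc k)
    then show ?case unfolding S_Suc using p(1) q(1) by auto
  qed
  have mono: "fst (S k) \<subseteq> fst (S j)" "snd (S k) \<subseteq> snd (S j)" if "k \<le> j" for k j
    using that by (auto intro!: lift_Suc_mono_le[of "\<lambda>k. fst (S k)" k j, THEN subsetD]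
        lift_Suc_mono_le[of "\<lambda>k. snd (S k)" k j, THEN subsetD] simp: S_Suc)
  let ?A = "\<Union>k. fst (S k)" and ?B = "\<Union>k. snd (S k)"
  have closed: "p i x u \<in> ?A" "q i x u \<in> ?B" if xu: "x \<in> ?A" "u \<in> ?B" for i x u
  proof -
    \<comment> \<open>The two coordinates may enter at different stages; at the later one both are
      present.\<close>
    obtain j k where "x \<in> fst (S j)" "u \<in> snd (S k)" using xu by blast
    then have "x \<in> fst (S (max j k))" "u \<in> snd (S (max j k))"
      using mono[of j "max j k"] mono[of k "max j k"] by auto
    then have "p i x u \<in> fst (S (Suc (max j k)))" "q i x u \<in> snd (S (Suc (max j k)))"
      unfolding S_Suc by force+
    then show "p i x u \<in> ?A" "q i x u \<in> ?B" by blast+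
  qed
  show ?thesis
  proof (rule that[of ?A ?B])
    show "x0 \<in> ?A" "u0 \<in> ?B" using S0 by (metis UN_I UNIV_I fst_conv snd_conv singletonI)+
    show "\<exists>y\<in>?A. P i x u y" if "x \<in> ?A" "u \<in> ?B" "y \<in> F" "P i x u y" for i x u y
      using closed(1)[OF that(1,2)] p(2)[OF that(3,4)] by blast
    show "\<exists>v\<in>?B. Q i x u v" if "x \<in> ?A" "u \<in> ?B" "v \<in> G" "Q i x u v" for i x u v
      using closed(2)[OF that(1,2)] q(2)[OF that(3,4)] by blast
  qed (use inv in auto)
qed

lemma countable_inj_infinite:
  assumes "countable A" and "infinite (UNIV :: 'b set)"
  obtains f :: "'a \<Rightarrow> 'b" where "inj_on f A"
proof -
  obtain h :: "nat \<Rightarrow> 'b" where "inj h"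
    using infinite_countable_subset[OF assms(2)] by blast
  then have "inj_on (h \<circ> to_nat_on A) A"
    using assms(1) by (intro comp_inj_on) (auto intro: inj_on_subset)
  then show ?thesis using that by blast
qed

text \<open>Evaluation \<open>(l, g) \<mapsto> g l\<close> preserves truth of all formulae from the
  countable subproduct to \<open>C\<close>, and the pair \<open>([], g0)\<close> is sent to the
  refuting point \<open>r\<close>.\<close>

lemma refuting_product:
  fixes C :: "(bimodality, 'w) frame" and d :: "'w \<Rightarrow> nat"
  assumes "commuting_frame (worlds C) (acc C Dia) (acc C Ex) r"
    and n: "n \<ge> 1"
    and d_bounds: "\<And>x. x \<in> worlds C \<Longrightarrow> 1 \<le> d x \<and> d x \<le> n"
    and d_less: "\<And>x y. (x, y) \<in> acc C Dia \<Longrightarrow> d y < d x"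
    and "\<not> sat C V r A"
    and "infinite (UNIV :: 'a set)" and "infinite (UNIV :: 'b set)"
  shows "\<exists>(F :: (unit, 'a) frame) (G :: (unit, 'b) frame).
    frame_of_logic (GL_depth n) F \<and> frame_of_logic S5 G \<and> \<not> valid (product_frame F G) A"
proof -
  interpret commuting_frame "worlds C" "acc C Dia" "acc C Ex" r by fact
  obtain g0 where g0: "section_map g0" "g0 [] = r"
    using exists_section[of "[]" r] r E_refl by auto
  obtain W1 W2 where W: "countable W1" "countable W2"
    "W1 \<subseteq> {l. node l}" "W2 \<subseteq> {g. section_map g}" "[] \<in> W1" "g0 \<in> W2"
    and witness_Dia: "\<And>B l g l'. l \<in> W1 \<Longrightarrow> g \<in> W2 \<Longrightarrow> l' \<in> {l. node l} \<Longrightarrow>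
      (l, l') \<in> tree \<and> sat C V (g l') B \<Longrightarrow> \<exists>l'\<in>W1. (l, l') \<in> tree \<and> sat C V (g l') B"
    and witness_Ex: "\<And>B l g h. l \<in> W1 \<Longrightarrow> g \<in> W2 \<Longrightarrow> h \<in> {g. section_map g} \<Longrightarrow>
      sat C V (h l) B \<Longrightarrow> \<exists>h\<in>W2. sat C V (h l) B"
    using countable_subproduct[of "[]" "{l. node l}" g0 "{g. section_map g}"
        "\<lambda>B l g l'. (l, l') \<in> tree \<and> sat C V (g l') B" "\<lambda>B l g h. sat C V (h l) B"] g0
    by (smt (verit) mem_Collect_eq node.simps(1))
  obtain i :: "('w \<times> nat) list \<Rightarrow> 'a" where i: "inj_on i W1"
    using countable_inj_infinite[OF W(1) assms(6)] .
  obtain j :: "(('w \<times> nat) list \<Rightarrow> 'w) \<Rightarrow> 'b" where j: "inj_on j W2"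
    using countable_inj_infinite[OF W(2) assms(7)] .
  let ?F = "\<lparr>worlds = i ` W1, acc = \<lambda>_::unit. {(i l, i l') | l l'. l \<in> W1 \<and> l' \<in> W1 \<and> (l, l') \<in> tree}\<rparr>"
  let ?G = "\<lparr>worlds = j ` W2, acc = \<lambda>_::unit. j ` W2 \<times> j ` W2\<rparr>"
  let ?V = "\<lambda>k. {(i l, j g) | l g. l \<in> W1 \<and> g \<in> W2 \<and> g l \<in> V k}"
  have i_eq: "i l = i l' \<longleftrightarrow> l = l'" if "l \<in> W1" "l' \<in> W1" for l l'
    using i that by (auto dest: inj_onD)
  have j_eq: "j g = j h \<longleftrightarrow> g = h" if "g \<in> W2" "h \<in> W2" for g h
    using j that by (auto dest: inj_onD)
  have truth: "sat (product_frame ?F ?G) ?V (i l, j g) B \<longleftrightarrow> sat C V (g l) B"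
    if "l \<in> W1" "g \<in> W2" for l g B
    using that
  proof (induction B arbitrary: l g)
    case (Var k)
    then show ?case using i_eq j_eq by auto
  next
    case (Poss m B)
    have lg: "node l" "section_map g" using Poss.prems W by auto
    have "acc C k \<subseteq> worlds C \<times> worlds C" for k
      using R_sub equiv_E by (cases k) (auto simp: equiv_def)
    then have sat_C: "sat C V (g l) (Poss k B) \<longleftrightarrow> (\<exists>w. (g l, w) \<in> acc C k \<and> sat C V w B)" for k
      unfolding sat.simps by blast
    show ?case
    proof (cases m)
      case Dia
      have "sat (product_frame ?F ?G) ?V (i l, j g) (Poss m B) \<longleftrightarrow>
          (\<exists>l'\<in>W1. (l, l') \<in> tree \<and> sat (product_frame ?F ?G) ?V (i l', j g) B)"
        using Poss.prems i_eq unfolding Dia product_frame_def by (auto; metis)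
      also have "\<dots> \<longleftrightarrow> (\<exists>l'\<in>W1. (l, l') \<in> tree \<and> sat C V (g l') B)"
        using Poss by auto
      also have "\<dots> \<longleftrightarrow> (\<exists>w. (g l, w) \<in> acc C Dia \<and> sat C V w B)"
      proof
        assume "\<exists>w. (g l, w) \<in> acc C Dia \<and> sat C V w B"
        \<comment> \<open>The section provides a node that may lie outside \<open>W1\<close>;
          closure under witnesses replaces it by one inside with the same property.\<close>
        then show "\<exists>l'\<in>W1. (l, l') \<in> tree \<and> sat C V (g l') B"
          using tree_successor[OF lg(2,1)] witness_Dia[OF Poss.prems]
          by (metis mem_Collect_eq)
      qed (use tree_section[OF lg(2)] in blast)
      finally show ?thesis
        unfolding Dia sat_C .
    next
      case Ex
      have "sat (product_frame ?F ?G) ?V (i l, j g) (Poss m B) \<longleftrightarrow>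
          (\<exists>h\<in>W2. sat (product_frame ?F ?G) ?V (i l, j h) B)"
        using Poss.prems unfolding Ex product_frame_def by auto
      also have "\<dots> \<longleftrightarrow> (\<exists>h\<in>W2. sat C V (h l) B)"
        using Poss by auto
      also have "\<dots> \<longleftrightarrow> (\<exists>w. (g l, w) \<in> acc C Ex \<and> sat C V w B)"
      proof
        assume "\<exists>h\<in>W2. sat C V (h l) B"
        then show "\<exists>w. (g l, w) \<in> acc C Ex \<and> sat C V w B"
          using section_E[OF lg(2) _ lg(1)] W(4) by blast
      next
        assume "\<exists>w. (g l, w) \<in> acc C Ex \<and> sat C V w B"
        then obtain w where w: "(g l, w) \<in> acc C Ex" "sat C V w B" by blast
        \<comment> \<open>Any point of the \<open>E\<close>-class of \<open>label l\<close> is the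
          value at \<open>l\<close> of some section; closure under witnesses then yields one in
          \<open>W2\<close>.\<close>
        then have "(w, label l) \<in> acc C Ex"
          using E_trans[OF E_sym[OF w(1)] section_label[OF lg(2,1)]] by simp
        then obtain h where "section_map h" "h l = w"
          using exists_section[OF lg(1)] by blast
        then show "\<exists>h\<in>W2. sat C V (h l) B"
          using w(2) witness_Ex[OF Poss.prems] by blast
      qed
      finally show ?thesis
        unfolding Ex sat_C .
    qed
  qed auto
  have "\<not> valid (product_frame ?F ?G) A"
  proof -
    have "(i [], j g0) \<in> worlds (product_frame ?F ?G)"
      using W by (auto simp: product_frame_def)
    moreover have "\<not> sat (product_frame ?F ?G) ?V (i [], j g0) A"
      using truth[OF W(5,6)] g0(2) assms(5) by simp
    ultimately show ?thesis
      unfolding valid_def by blast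
  qed
  moreover have "frame_of_logic (GL_depth n) ?F"
  proof (rule frame_of_GL_depth[OF n])
    \<comment> \<open>The rank is pulled back along \<open>g0\<close>, which maps tree steps to
      \<open>Dia\<close>-steps.\<close>
    let ?d = "\<lambda>x. d (g0 (inv_into W1 i x))"
    show "kripke_frame ?F"
      using W(5) by (auto simp: kripke_frame_def)
    show "trans (acc ?F ())"
      using i_eq transD[OF trans_tree] by (auto simp: trans_def) metis
    show "1 \<le> ?d x \<and> ?d x \<le> n" if "x \<in> worlds ?F" for x
    proof -
      have "g0 l \<in> worlds C" if "l \<in> W1" for l
        using that W(3) E_in[OF section_label[OF g0(1)]] by blast
      then show ?thesis
        using that i d_bounds by auto
    qed
    show "?d y < ?d x" if "(x, y) \<in> acc ?F ()" for x y
      using that i d_less tree_section[OF g0(1)] by auto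
  qed
  moreover have "frame_of_logic S5 ?G"
    using W(6) by (intro frame_of_S5) (auto simp: equiv_def refl_on_def sym_def trans_def)
  ultimately show ?thesis by blast
qed

section \<open>Completeness by refuting non-theorems in products\<close>

theorem corollary3p10:
  fixes n :: nat
  assumes "n \<ge> 1"
    and "infinite (UNIV :: 'a set)" and "infinite (UNIV :: 'b set)"
  shows "product_matching TYPE('a) TYPE('b) (GL_depth n)"
proof -
  interpret commutator_GL n by standard fact
  have "A \<in> M"
    if valid: "\<And>(F :: (unit, 'a) frame) (G :: (unit, 'b) frame).
      frame_of_logic (GL_depth n) F \<Longrightarrow> frame_of_logic S5 G \<Longrightarrow> valid (product_frame F G) A" for A
  proof (rule ccontr)
    assume "A \<notin> M"
    then obtain \<Gamma> where \<Gamma>: "mcs \<Gamma>" "A \<notin> \<Gamma>"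
      using exists_mcs by blast
    have "commuting_frame (worlds canonical) (acc canonical Dia) (acc canonical Ex) \<Gamma>"
    proof
      show "acc canonical Dia \<subseteq> worlds canonical \<times> worlds canonical"
        using can_accD by (fastforce simp: canonical_def)
    qed (simp_all add: canonical_def trans_Dia equiv_Ex can_acc_commute \<Gamma>(1))
    moreover have "\<not> sat canonical (\<lambda>i. {\<Gamma>. Var i \<in> \<Gamma>}) \<Gamma> A"
      using canonical_truth[OF \<Gamma>(1)] \<Gamma>(2) by blast
    moreover have "1 \<le> depth \<Delta> \<and> depth \<Delta> \<le> n" if "\<Delta> \<in> worlds canonical" for \<Delta>
      using that depth_bounds by (simp add: canonical_def)
    moreover have "depth \<Theta> < depth \<Delta>" if "(\<Delta>, \<Theta>) \<in> acc canonical Dia" for \<Delta> \<Theta>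
      using that depth_less by (simp add: canonical_def)
    ultimately obtain F :: "(unit, 'a) frame" and G :: "(unit, 'b) frame"
      where "frame_of_logic (GL_depth n) F" "frame_of_logic S5 G" "\<not> valid (product_frame F G) A"
      using refuting_product[of canonical \<Gamma> n depth "\<lambda>i. {\<Gamma>. Var i \<in> \<Gamma>}" A] assms by metis
    then show False using valid by blast
  qed
  then show ?thesis
    using commutator_sound unfolding product_matching_def product_S5_def by blast
qed

end
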